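(* Assume A1, A2 and A3 (stated in the context). Let $x_k\in B_\rho(x_0)$ satisfy $F'(x_k)^*F_0(x_k)\neq0$, let $\theta_k\in(0,2)$, and let $$x_{k+1}:=x_k-\theta_k\,\frac{(1-\eta)\|F_0(x_k)\|^2}{\|F'(x_k)^*F_0(x_k)\|^2}\,F'(x_k)^*F_0(x_k).$$ Then, for all $x^\star\in B_\rho(x_0)\cap F^{-1}(y)$, $$\|x^\star-x_k\|^2\ \ge\ \|x^\star-x_{k+1}\|^2+\theta_k(2-\theta_k)\left((1-\eta)\frac{\|F_0(x_k)\|^2}{\|F'(x_k)^*F_0(x_k)\|}\right)^2.$$
   Context: $X,Y$ are real Hilbert spaces, $F:D(F)\subset X\to Y$ is a (nonlinear) operator, $y\in Y$, $F_0(x):=F(x)-y$, and $F^{-1}(y)=\{x\in D(F):F(x)=y\}$. $B_r(z)$ denotes the open ball of radius $r$ centered at $z$ in $X$. A1: $F$ is continuous on $D(F)$, which has nonempty interior; there are constants $C,\rho>0$ and $x_0\in D(F)$ with $B_\rho(x_0)\subset D(F)$ such that the Gateaux derivative $F'(x)$ (a bounded linear operator $X\to Y$) exists for $x\in B_\rho(x_0)$ and $\|F'(x)\|\le C$ there. A2 (tangential cone condition): there is a constant $\eta\in[0,1)$ such that $\|F(\bar x)-F(x)-F'(x)(\bar x-x)\|\le\eta\|F(\bar x)-F(x)\|$ for all $x,\bar x\in B_\rho(x_0)$. A3: there is $x^\star\in B_{\rho/2}(x_0)$ with $F(x^\star)=y$. *)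

theory Defs
  imports "HOL-Analysis.Analysis"
begin

text \<open>
  Gateaux differentiability at a point \<open>x\<close>, with a bounded linear derivative \<open>T\<close>. Operators
  with domain \<open>D\<close> are represented by total functions; the limit depends only on the values on
  \<open>D\<close> provided \<open>x\<close> is an interior point of \<open>D\<close>, which is the only situation in which the
  predicate is meant to be used.
\<close>

definition has_gateaux_derivative ::
  "('a::real_normed_vector \<Rightarrow> 'b::real_normed_vector) \<Rightarrow> ('a \<Rightarrow>\<^sub>L 'b) \<Rightarrow> 'a \<Rightarrow> bool"
  where "has_gateaux_derivative F T x \<longleftrightarrow>
    (\<forall>h. ((\<lambda>t::real. (F (x + t *\<^sub>R h) - F x) /\<^sub>R t) \<longlongrightarrow> blinfun_apply T h) (at 0))"

text \<open>
  The library constant \<open>adjoint\<close> picks some \<open>g\<close> with \<open>T u \<bullet> v = u \<bullet> g v\<close> for all \<open>u\<close>, \<open>v\<close>.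
  Such a \<open>g\<close> is unique, and for bounded linear \<open>T\<close> on a Hilbert space it exists by the Riesz
  representation theorem, so below it is the Hilbert space adjoint.
\<close>

abbreviation hilbert_adjoint ::
  "('a::{real_inner,complete_space} \<Rightarrow>\<^sub>L 'b::{real_inner,complete_space}) \<Rightarrow> 'b \<Rightarrow> 'a"
  where "hilbert_adjoint T \<equiv> adjoint (blinfun_apply T)"

end

theory Submission
  imports Defs
begin

text \<open>
  Write \<open>r = F (x k) - y\<close> and \<open>g\<close> for the adjoint of \<open>F' (x k)\<close> applied to \<open>r\<close>. The tangential
  cone condition at a solution \<open>xs\<close> bounds the inner product of \<open>g\<close> and \<open>xs - x k\<close> by
  \<open>- (1 - \<eta>) * (norm r)\<^sup>2\<close>, that is, it puts \<open>xs\<close> in a half-space with normal vector \<open>g\<close>. The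
  iteration is a relaxed projection onto this half-space, and expanding the square gives the claim.
  The adjoint exists by the Riesz representation theorem, whose representing vector is the
  minimizer of \<open>u \<mapsto> (norm u)\<^sup>2 / 2 - f u\<close>.
\<close>

lemma riesz_representation:
  fixes f :: "'a::{real_inner,complete_space} \<Rightarrow> real"
  assumes "bounded_linear f"
  obtains u where "\<And>v. f v = v \<bullet> u"
proof -
  interpret f: bounded_linear f by fact
  define J where "J u = (norm u)\<^sup>2 / 2 - f u" for u
  obtain K where K: "\<And>u. norm (f u) \<le> norm u * K"
    using f.bounded by blast
  \<comment> \<open>Completing the square absorbs the linear term: \<open>norm u * K\<close> is at
    most half of \<open>(norm u)\<^sup>2 + K\<^sup>2\<close>.\<close>
  have lower: "- K\<^sup>2 / 2 \<le> J u" for u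
  proof -
    have "f u \<le> norm u * K" using K[of u] by simp
    moreover have "0 \<le> (norm u - K)\<^sup>2" by simp
    ultimately show ?thesis by (simp add: J_def power2_diff)
  qed
  define m where "m = (INF u. J u)"
  have bdd: "bdd_below (range J)"
    using lower by (intro bdd_belowI2)
  have m_le: "m \<le> J u" for u
    unfolding m_def by (rule cINF_lower[OF bdd]) simp
  have "\<exists>u. J u < m + 1 / Suc n" for n
    using cInf_lessD[of "range J" "m + 1 / Suc n"] by (auto simp: m_def)
  then obtain U where U: "\<And>n. J (U n) < m + 1 / Suc n"
    by metis
  \<comment> \<open>The parallelogram law; the contributions of \<open>f\<close> cancel by
    linearity. As the midpoint has value at least \<open>m\<close>, two near-minimizers must be
    close.\<close>
  have parallelogram: "(norm (u - v))\<^sup>2 / 4 = J u + J v - 2 * J ((1/2) *\<^sub>R (u + v))" for u v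
    by (simp add: J_def f.scaleR f.add power2_norm_eq_inner inner_simps inner_commute field_simps)
  have "Cauchy U"
  proof (rule metric_CauchyI)
    fix e :: real assume "0 < e"
    \<comment> \<open>Both \<open>J (U i)\<close> and \<open>J (U j)\<close> will exceed
      \<open>m\<close> by less than this, so a quarter of the squared distance stays below
      \<open>e\<^sup>2 / 4\<close>.\<close>
    then have "0 < e\<^sup>2 / 8" by simp
    then obtain M where M: "1 / Suc M < e\<^sup>2 / 8"
      using nat_approx_posE by blast
    have "dist (U i) (U j) < e" if "M \<le> i" "M \<le> j" for i j
    proof -
      have "1 / Suc i \<le> 1 / Suc M" "1 / Suc j \<le> 1 / Suc M"
        using that by (auto intro!: divide_left_mono)
      then have "(norm (U i - U j))\<^sup>2 < e\<^sup>2"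
        using parallelogram[of "U i" "U j"] U[of i] U[of j] M
          m_le[of "(1/2) *\<^sub>R (U i + U j)"] by linarith
      then show ?thesis
        using power2_less_imp_less[of "norm (U i - U j)" e] \<open>0 < e\<close> by (simp add: dist_norm)
    qed
    then show "\<exists>M. \<forall>i\<ge>M. \<forall>j\<ge>M. dist (U i) (U j) < e" by blast
  qed
  then obtain u where u: "U \<longlonglongrightarrow> u"
    using Cauchy_convergent convergent_def by blast
  have "(\<lambda>n. J (U n)) \<longlonglongrightarrow> J u"
    unfolding J_def by (intro tendsto_intros f.tendsto u) simp
  moreover have "(\<lambda>n. m + 1 / Suc n) \<longlonglongrightarrow> m + 0"
    by (intro tendsto_intros LIMSEQ_Suc[OF lim_1_over_n])
  ultimately have "J u \<le> m + 0"
    by (rule LIMSEQ_le) (use U less_imp_le in blast)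
  then have minimal: "J u \<le> J v" for v
    using m_le[of v] by simp
  have "f v = v \<bullet> u" for v
  proof (cases "v = 0")
    case False
    \<comment> \<open>\<open>t\<close> minimizes \<open>J\<close> along the line through
      \<open>u\<close> in direction \<open>v\<close>. The drop there is half of
      \<open>d\<^sup>2 / (v \<bullet> v)\<close>, so minimality of \<open>u\<close> forces
      \<open>d = 0\<close>.\<close>
    define d t where "d = f v - v \<bullet> u" and "t = d / (v \<bullet> v)"
    have "J (u + t *\<^sub>R v) = J u - t * d + t\<^sup>2 * (v \<bullet> v) / 2"
      unfolding J_def d_def power2_norm_eq_inner
      by (simp add: f.scaleR f.add inner_simps inner_commute power2_eq_square field_simps)
    also have "\<dots> = J u - d\<^sup>2 / (v \<bullet> v) / 2"
      using False by (simp add: t_def power2_eq_square field_simps)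
    finally have "d\<^sup>2 / (v \<bullet> v) \<le> 0"
      using minimal[of "u + t *\<^sub>R v"] by simp
    moreover have "0 < v \<bullet> v" using False by simp
    ultimately have "d\<^sup>2 \<le> 0" by (simp add: divide_le_0_iff)
    then show ?thesis by (simp add: d_def)
  qed (simp add: f.zero)
  then show thesis by (rule that)
qed

text \<open>\<open>adjoint\<close> is a choice, so its defining identity needs a witness: for each
  \<open>v\<close>, Riesz represents the functional sending \<open>u\<close> to
  \<open>blinfun_apply T u \<bullet> v\<close>.\<close>

lemma inner_hilbert_adjoint:
  fixes T :: "'a::{real_inner,complete_space} \<Rightarrow>\<^sub>L 'b::{real_inner,complete_space}"
  shows "u \<bullet> hilbert_adjoint T v = blinfun_apply T u \<bullet> v"
proof -
  have "\<exists>w. \<forall>u. blinfun_apply T u \<bullet> v = u \<bullet> w" for v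
  proof -
    have "bounded_linear (\<lambda>u. blinfun_apply T u \<bullet> v)"
      by (intro bounded_linear_inner_left_comp blinfun.bounded_linear_right)
    then show ?thesis by (rule riesz_representation) blast
  qed
  then have "\<exists>g. \<forall>u v. blinfun_apply T u \<bullet> v = u \<bullet> g v"
    by metis
  then show ?thesis
    unfolding adjoint_def by (rule someI2_ex) simp
qed

text \<open>Here \<open>e\<close> points from the iterate to a solution. For \<theta> = 1 the step
  ends on the bounding hyperplane of the half-space, at distance \<open>a / norm g\<close>.\<close>

lemma norm_add_scaleR_relaxed_step:
  fixes e g :: "'a::real_inner"
  assumes "g \<noteq> 0" "0 \<le> \<theta>" "0 \<le> a" "e \<bullet> g \<le> - a"
  shows "(norm (e + (\<theta> * (a / (norm g)\<^sup>2)) *\<^sub>R g))\<^sup>2 + \<theta> * (2 - \<theta>) * (a / norm g)\<^sup>2 \<le> (norm e)\<^sup>2"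
proof -
  define s where "s = \<theta> * (a / (norm g)\<^sup>2)"
  have "0 \<le> s" using assms by (simp add: s_def)
  have "(norm (e + s *\<^sub>R g))\<^sup>2 = (norm e)\<^sup>2 + 2 * s * (e \<bullet> g) + s\<^sup>2 * (norm g)\<^sup>2"
    unfolding power2_norm_eq_inner
    by (simp add: inner_simps inner_commute[of g e] power2_eq_square algebra_simps)
  also have "\<dots> \<le> (norm e)\<^sup>2 + 2 * s * (- a) + s\<^sup>2 * (norm g)\<^sup>2"
    using mult_left_mono[OF assms(4), of "2 * s"] \<open>0 \<le> s\<close> by simp
  also have "\<dots> = (norm e)\<^sup>2 - \<theta> * (2 - \<theta>) * (a / norm g)\<^sup>2"
    using assms(1) by (simp add: s_def power2_eq_square field_simps)
  finally show ?thesis by (simp add: s_def)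
qed

text \<open>Cauchy-Schwarz for \<open>r + d\<close> against \<open>r\<close>. In the application
  \<open>d\<close> is the derivative at the iterate applied to the error, and \<open>- r\<close> is
  the exact change of \<open>F\<close>.\<close>

lemma inner_residual_le:
  fixes r d :: "'a::real_inner"
  assumes "norm (- r - d) \<le> \<eta> * norm r"
  shows "d \<bullet> r \<le> - ((1 - \<eta>) * (norm r)\<^sup>2)"
proof -
  have "(r + d) \<bullet> r \<le> norm (r + d) * norm r"
    by (rule norm_cauchy_schwarz)
  also have "norm (r + d) = norm (- r - d)"
    using norm_minus_cancel[of "r + d"] by simp
  also have "\<dots> * norm r \<le> \<eta> * norm r * norm r"
    using assms by (intro mult_right_mono) auto
  finally show ?thesis
    by (simp add: inner_simps power2_norm_eq_inner[symmetric] power2_eq_square algebra_simps)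
qed

theorem proposition3p2:
  fixes F :: "'a::{real_inner,complete_space} \<Rightarrow> 'b::{real_inner,complete_space}"
    and D :: "'a set" and F' :: "'a \<Rightarrow> 'a \<Rightarrow>\<^sub>L 'b"
    and y :: 'b and x0 :: 'a and C \<rho> \<eta> :: real
    and x :: "nat \<Rightarrow> 'a" and \<theta> :: "nat \<Rightarrow> real" and k :: nat
  assumes A1: "continuous_on D F" "interior D \<noteq> {}" "C > 0" "\<rho> > 0" "x0 \<in> D" "ball x0 \<rho> \<subseteq> D"
      "\<forall>z\<in>ball x0 \<rho>. has_gateaux_derivative F (F' z) z \<and> norm (F' z) \<le> C"
    and A2: "0 \<le> \<eta>" "\<eta> < 1"
      "\<forall>z\<in>ball x0 \<rho>. \<forall>w\<in>ball x0 \<rho>.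
         norm (F w - F z - blinfun_apply (F' z) (w - z)) \<le> \<eta> * norm (F w - F z)"
    and A3: "\<exists>z\<in>ball x0 (\<rho>/2). F z = y"
    and xk: "x k \<in> ball x0 \<rho>" "hilbert_adjoint (F' (x k)) (F (x k) - y) \<noteq> 0"
    and \<theta>k: "0 < \<theta> k" "\<theta> k < 2"
    and step: "x (Suc k) = x k -
      (\<theta> k * (((1 - \<eta>) * (norm (F (x k) - y))\<^sup>2) /
              (norm (hilbert_adjoint (F' (x k)) (F (x k) - y)))\<^sup>2))
        *\<^sub>R hilbert_adjoint (F' (x k)) (F (x k) - y)"
  shows "\<forall>xs \<in> ball x0 \<rho> \<inter> {z \<in> D. F z = y}.
    (norm (xs - x k))\<^sup>2 \<ge> (norm (xs - x (Suc k)))\<^sup>2 +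
      \<theta> k * (2 - \<theta> k) *
      ((1 - \<eta>) * ((norm (F (x k) - y))\<^sup>2 / norm (hilbert_adjoint (F' (x k)) (F (x k) - y))))\<^sup>2"
proof
  fix xs assume xs: "xs \<in> ball x0 \<rho> \<inter> {z \<in> D. F z = y}"
  define r where "r = F (x k) - y"
  define g where "g = hilbert_adjoint (F' (x k)) r"
  define a where "a = (1 - \<eta>) * (norm r)\<^sup>2"
  \<comment> \<open>The cone condition is based at \<open>x k\<close>, where the derivative of the
    step is taken, with the solution as the other point.\<close>
  have "norm (F xs - F (x k) - blinfun_apply (F' (x k)) (xs - x k)) \<le> \<eta> * norm (F xs - F (x k))"
    using A2(3) xk(1) xs by blast
  moreover have "F xs - F (x k) = - r" using xs by (simp add: r_def)
  ultimately have "norm (- r - blinfun_apply (F' (x k)) (xs - x k)) \<le> \<eta> * norm r"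
    by simp
  \<comment> \<open>Moving the adjoint across the inner product turns the residual bound into the
    half-space condition.\<close>
  then have "(xs - x k) \<bullet> g \<le> - a"
    unfolding g_def a_def inner_hilbert_adjoint by (rule inner_residual_le)
  moreover have "g \<noteq> 0" "0 \<le> \<theta> k" "0 \<le> a"
    using xk(2) \<theta>k(1) A2(2) by (auto simp: g_def r_def a_def)
  ultimately have "(norm (xs - x k + (\<theta> k * (a / (norm g)\<^sup>2)) *\<^sub>R g))\<^sup>2
      + \<theta> k * (2 - \<theta> k) * (a / norm g)\<^sup>2 \<le> (norm (xs - x k))\<^sup>2"
    by (intro norm_add_scaleR_relaxed_step)
  moreover have diff: "xs - x (Suc k) = xs - x k + (\<theta> k * (a / (norm g)\<^sup>2)) *\<^sub>R g"
    unfolding step a_def g_def r_def by simp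
  ultimately show "(norm (xs - x k))\<^sup>2 \<ge> (norm (xs - x (Suc k)))\<^sup>2 +
      \<theta> k * (2 - \<theta> k) *
      ((1 - \<eta>) * ((norm (F (x k) - y))\<^sup>2 / norm (hilbert_adjoint (F' (x k)) (F (x k) - y))))\<^sup>2"
    unfolding diff by (simp add: a_def g_def r_def)
qed

end
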